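(* The real $2\times 2$ matrices $X$ with $X^2=I_2$ are exactly the matrices $I_2$, $-I_2$ and the matrices $$\begin{bmatrix}\cosh t\cos\phi & \cosh t\sin\phi+\sinh t\\ \cosh t\sin\phi-\sinh t & -\cosh t\cos\phi\end{bmatrix},\qquad t,\phi\in\mathbb R.$$
   Context: $I_2$ denotes the $2\times 2$ identity matrix. *)

theory Defs
  imports "HOL-Analysis.Analysis"
begin

end

theory Submission
  imports Defs
begin

text \<open>
  Write \<open>X\<close> with rows \<open>(a, b)\<close> and \<open>(c, d)\<close>.  The off-diagonal entries of \<open>X\<^sup>2\<close> are \<open>b (a + d)\<close> and
  \<open>c (a + d)\<close>, so the trace decides the shape of an involution.  If the trace is nonzero, then
  \<open>X\<close> is diagonal with \<open>a\<^sup>2 = d\<^sup>2 = 1\<close> and \<open>a \<noteq> - d\<close>, that is, \<open>X\<close> is plus or minus the identity.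
  If the trace is zero, the only remaining condition is \<open>a\<^sup>2 + b c = 1\<close>.  Splitting the
  off-diagonal part into its symmetric part \<open>s = (b + c) / 2\<close> and skew part \<open>h = (b - c) / 2\<close>
  turns this into the equation \<open>a\<^sup>2 + s\<^sup>2 - h\<^sup>2 = 1\<close> of a one-sheeted hyperboloid.  The given
  family is its usual parametrization by the height \<open>h = sinh t\<close> and the angle \<open>\<phi>\<close> of the point
  \<open>(a, s)\<close> on the circle of radius \<open>cosh t\<close> at that height.
\<close>

lemma matrix_2x2_eq_vector_iff:
  fixes X :: "real ^ 2 ^ 2"
  shows "X = vector [vector [a, b], vector [c, d]] \<longleftrightarrow>
    X $ 1 $ 1 = a \<and> X $ 1 $ 2 = b \<and> X $ 2 $ 1 = c \<and> X $ 2 $ 2 = d"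
  by (auto simp: vec_eq_iff forall_2)

lemma involution_2x2_iff_entries:
  fixes X :: "real ^ 2 ^ 2"
  shows "X ** X = mat 1 \<longleftrightarrow>
    (X $ 1 $ 1)\<^sup>2 + X $ 1 $ 2 * X $ 2 $ 1 = 1 \<and>
    (X $ 2 $ 2)\<^sup>2 + X $ 1 $ 2 * X $ 2 $ 1 = 1 \<and>
    X $ 1 $ 2 * (X $ 1 $ 1 + X $ 2 $ 2) = 0 \<and>
    X $ 2 $ 1 * (X $ 1 $ 1 + X $ 2 $ 2) = 0"
  by (simp add: vec_eq_iff forall_2 matrix_matrix_mult_def sum_2 mat_def
      power2_eq_square algebra_simps) argo

text \<open>
  At height \<open>h\<close> the section of the hyperboloid is a circle of radius \<open>sqrt (1 + h\<^sup>2)\<close>, which is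
  \<open>cosh t\<close> for \<open>t = arsinh h\<close>; this radius is positive, so the section has an angular coordinate.
\<close>

lemma hyperboloid_parametrization:
  fixes a s h :: real
  assumes "a\<^sup>2 + s\<^sup>2 = 1 + h\<^sup>2"
  obtains t \<phi> where "a = cosh t * cos \<phi>" "s = cosh t * sin \<phi>" "h = sinh t"
proof -
  define t where "t = arsinh h"
  have h: "h = sinh t" by (simp add: t_def)
  have pos: "cosh t > 0" by simp
  have "a\<^sup>2 + s\<^sup>2 = (cosh t)\<^sup>2" using assms h by (simp add: cosh_square_eq)
  then have "(a / cosh t)\<^sup>2 + (s / cosh t)\<^sup>2 = 1"
    using pos by (simp add: power_divide flip: add_divide_distrib)
  then obtain \<phi> where "a / cosh t = cos \<phi>" "s / cosh t = sin \<phi>"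
    using sincos_total_2pi by metis
  with pos have "a = cosh t * cos \<phi>" "s = cosh t * sin \<phi>"
    by (simp_all add: field_simps)
  with h show thesis using that by blast
qed

lemma hyperboloid_parametrization_off_diagonal:
  fixes t \<phi> :: real
  shows "(cosh t * cos \<phi>)\<^sup>2 +
    (cosh t * sin \<phi> + sinh t) * (cosh t * sin \<phi> - sinh t) = 1"
proof -
  have "(cosh t * cos \<phi>)\<^sup>2 + (cosh t * sin \<phi> + sinh t) * (cosh t * sin \<phi> - sinh t)
      = (cosh t)\<^sup>2 * ((sin \<phi>)\<^sup>2 + (cos \<phi>)\<^sup>2) - (sinh t)\<^sup>2"
    by algebra
  then show ?thesis by (simp add: cosh_square_eq)
qed

theorem mainTheorem6:
  shows "{X :: real ^ 2 ^ 2. X ** X = mat 1} =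
    {mat 1, - mat 1} \<union>
    {vector [vector [cosh t * cos \<phi>, cosh t * sin \<phi> + sinh t],
             vector [cosh t * sin \<phi> - sinh t, - cosh t * cos \<phi>]] | t \<phi> :: real. True}"
  (is "?L = ?S \<union> ?F")
proof (intro equalityI subsetI)
  fix X :: "real ^ 2 ^ 2"
  assume "X \<in> ?L"
  then have aa: "(X $ 1 $ 1)\<^sup>2 + X $ 1 $ 2 * X $ 2 $ 1 = 1"
    and dd: "(X $ 2 $ 2)\<^sup>2 + X $ 1 $ 2 * X $ 2 $ 1 = 1"
    and tr: "X $ 1 $ 2 * (X $ 1 $ 1 + X $ 2 $ 2) = 0" "X $ 2 $ 1 * (X $ 1 $ 1 + X $ 2 $ 2) = 0"
    by (simp_all add: involution_2x2_iff_entries)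
  show "X \<in> ?S \<union> ?F"
  proof (cases "X $ 1 $ 1 + X $ 2 $ 2 = 0")
    case False
    with tr have off: "X $ 1 $ 2 = 0" "X $ 2 $ 1 = 0" by simp_all
    with aa dd have "X $ 1 $ 1 = 1 \<or> X $ 1 $ 1 = - 1" "X $ 2 $ 2 = 1 \<or> X $ 2 $ 2 = - 1"
      by (simp_all add: power2_eq_1_iff)
    with False have "X $ 1 $ 1 = 1 \<and> X $ 2 $ 2 = 1 \<or> X $ 1 $ 1 = - 1 \<and> X $ 2 $ 2 = - 1"
      by auto
    with off have "X = mat 1 \<or> X = - mat 1"
      by (auto simp: vec_eq_iff forall_2 mat_def)
    then show ?thesis by blast
  next
    case True
    have "(X $ 1 $ 1)\<^sup>2 + ((X $ 1 $ 2 + X $ 2 $ 1) / 2)\<^sup>2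
        = 1 + ((X $ 1 $ 2 - X $ 2 $ 1) / 2)\<^sup>2"
      using aa by (simp add: power2_eq_square field_simps)
    then obtain t \<phi> where "X $ 1 $ 1 = cosh t * cos \<phi>"
      "(X $ 1 $ 2 + X $ 2 $ 1) / 2 = cosh t * sin \<phi>" "(X $ 1 $ 2 - X $ 2 $ 1) / 2 = sinh t"
      by (rule hyperboloid_parametrization)
    with True have "X = vector [vector [cosh t * cos \<phi>, cosh t * sin \<phi> + sinh t],
             vector [cosh t * sin \<phi> - sinh t, - cosh t * cos \<phi>]]"
      unfolding matrix_2x2_eq_vector_iff by (simp add: field_simps)
    then show ?thesis by blast
  qed
next
  fix X :: "real ^ 2 ^ 2"
  assume "X \<in> ?S \<union> ?F"
  then consider "X = mat 1" | "X = - mat 1"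
    | t \<phi> where "X = vector [vector [cosh t * cos \<phi>, cosh t * sin \<phi> + sinh t],
             vector [cosh t * sin \<phi> - sinh t, - cosh t * cos \<phi>]]"
    by blast
  then have "X ** X = mat 1"
  proof cases
    case 3
    then show ?thesis
      using hyperboloid_parametrization_off_diagonal[of t \<phi>]
      by (simp add: involution_2x2_iff_entries matrix_2x2_eq_vector_iff)
  qed (unfold involution_2x2_iff_entries, simp_all add: mat_def)
  then show "X \<in> ?L" by simp
qed

end
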